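(* Let $y=y(t)$ be a smooth function on an open interval with $y'''(t)>0$, and write $y'''(t)=e^{p(t)}$ and $u(t)=\tfrac32 p'(t)$. Then $y$ satisfies the $7^{\text{th}}$ order nonlinear ODE $$10 (y^{(3)})^3y^{(7)}-70(y^{(3)})^2y^{(4)} y^{(6)}-49(y^{(3)})^2(y^{(5)})^2+280\, y^{(3)}(y^{(4)})^2y^{(5)}-175(y^{(4)})^4=0$$ if and only if $u$ satisfies the generalised Chazy equation with Chazy parameter $k^2=\left(\tfrac32\right)^2=\tfrac94$, namely $$u'''-2 u'' u+3 (u')^2-\frac{4}{36-\left(\frac{3}{2}\right)^2} \big(6 u' -u^2\big)^2=0.$$
   Context: Primes and superscripts in parentheses denote derivatives with respect to $t$. The generalised Chazy equation with Chazy parameter $k$ ($k\neq\pm6$) for $y(x)$ is $y'''-2yy''+3(y')^2-\frac{4}{36-k^2}(6y'-y^2)^2=0$. *)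

theory Defs
  imports "HOL-Analysis.Analysis"
begin

(* Only used on open sets, where the iterated deriv at a point depends only on the values of
   the function near that point. *)
definition smooth_on :: "real set \<Rightarrow> (real \<Rightarrow> real) \<Rightarrow> bool" where
  "smooth_on S f \<longleftrightarrow> (\<forall>n. (deriv ^^ n) f differentiable_on S)"

(* Differentiability is demanded explicitly because deriv is total. *)
definition satisfies_generalised_chazy_on :: "real set \<Rightarrow> real \<Rightarrow> (real \<Rightarrow> real) \<Rightarrow> bool" where
  "satisfies_generalised_chazy_on S k u \<longleftrightarrow>
     k \<noteq> 6 \<and> k \<noteq> -6 \<and>
     (\<forall>n<3. (deriv ^^ n) u differentiable_on S) \<and>
     (\<forall>t\<in>S. (deriv ^^ 3) u t - 2 * u t * (deriv ^^ 2) u t + 3 * (deriv u t)\<^sup>2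
            - 4 / (36 - k\<^sup>2) * (6 * deriv u t - (u t)\<^sup>2)\<^sup>2 = 0)"

end

theory Submission
  imports Defs
begin

text \<open>
  Write \<open>w = y'''\<close> and \<open>a\<^sub>j = w\<^sup>(\<^sup>j\<^sup>) / w\<close>. Since \<open>w = exp p\<close>, one has \<open>p' = w' / w = a\<^sub>1\<close>, so
  \<open>u = 3/2 a\<^sub>1\<close>. The quotients are closed under differentiation,
  \<open>a\<^sub>j' = a\<^sub>j\<^sub>+\<^sub>1 - a\<^sub>1 a\<^sub>j\<close>, so \<open>u'\<close>, \<open>u''\<close> and \<open>u'''\<close> are polynomials in \<open>a\<^sub>1, \<dots>, a\<^sub>4\<close>
  (\<open>3/2\<close> times the cumulants of the ``moments'' \<open>a\<^sub>j\<close>).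

  The seventh-order equation is homogeneous of degree 4 in \<open>w, w', \<dots>, w''''\<close>; dividing it by
  \<open>w\<^sup>4\<close> gives another polynomial in \<open>a\<^sub>1, \<dots>, a\<^sub>4\<close>. For \<open>k\<^sup>2 = 9/4\<close> this polynomial is exactly
  \<open>20/3\<close> times the left-hand side of the Chazy equation, which is the content of
  \<open>chazy_quotient_identity\<close>. As \<open>w > 0\<close>, the two equations hold at the same points.
\<close>

lemma smooth_on_has_real_derivative:
  assumes "open S" "smooth_on S f" "t \<in> S"
  shows "((deriv ^^ n) f has_real_derivative (deriv ^^ Suc n) f t) (at t)"
proof -
  have "(deriv ^^ n) f differentiable (at t)"
    using assms by (simp add: smooth_on_def differentiable_on_eq_differentiable_at)
  then show ?thesis
    by (simp add: DERIV_deriv_iff_real_differentiable)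
qed

text \<open>A formula for a function on an open set may be differentiated there, because a derivative
  depends only on the germ of the function; off the set the function can be arbitrary.\<close>

lemma has_real_derivative_transfer_on_open:
  assumes "open S" "t \<in> S" "\<And>s. s \<in> S \<Longrightarrow> f s = g s"
    and "(g has_real_derivative D) (at t)"
  shows "(f has_real_derivative D) (at t)"
  using has_field_derivative_transform_within_open[OF assms(4,1,2)] assms(3) by simp

text \<open>The quotient rule, arranged so that the derivative of a quotient by \<open>w\<close> is again a polynomial
  in quotients by \<open>w\<close>.\<close>

lemma has_real_derivative_quotient_by_base:
  fixes w v :: "real \<Rightarrow> real"
  assumes "(w has_real_derivative w') (at t)" "(v has_real_derivative v') (at t)" "w t \<noteq> 0"
  shows "((\<lambda>s. v s / w s) has_real_derivative v' / w t - w' / w t * (v t / w t)) (at t)"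
  using assms by (auto intro!: derivative_eq_intros simp: field_simps)

text \<open>Here \<open>aj\<close> stands for \<open>w\<^sup>(\<^sup>j\<^sup>) / w\<close>, and the hypotheses are the resulting values of \<open>u\<close> and its
  derivatives. In terms of \<open>q = a1\<close>, with \<open>a2 = q' + q\<^sup>2\<close> and so on, both sides are \<open>w\<^sup>4\<close> times
  \<open>10 q''' - 30 q q'' - 19 q'\<^sup>2 + 32 q\<^sup>2 q' - 4 q\<^sup>4\<close>. The value \<open>k\<^sup>2 = 9/4\<close>, which gives
  \<open>4 / (36 - k\<^sup>2) = 16/135\<close>, makes the last three coefficients agree.\<close>

lemma chazy_quotient_identity:
  fixes w a1 a2 a3 a4 k :: real
  assumes "k\<^sup>2 = (3 / 2)\<^sup>2"
    and "u0 = 3 / 2 * a1"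
    and "u1 = 3 / 2 * (a2 - a1^2)"
    and "u2 = 3 / 2 * (a3 - 3 * a1 * a2 + 2 * a1^3)"
    and "u3 = 3 / 2 * (a4 - 4 * a1 * a3 - 3 * a2^2 + 12 * a1^2 * a2 - 6 * a1^4)"
  shows "10 * w^3 * (w * a4) - 70 * w^2 * (w * a1) * (w * a3) - 49 * w^2 * (w * a2)^2
           + 280 * w * (w * a1)^2 * (w * a2) - 175 * (w * a1)^4
         = 20 / 3 * w^4 * (u3 - 2 * u0 * u2 + 3 * u1^2
             - 4 / (36 - k\<^sup>2) * (6 * u1 - u0^2)^2)"
proof -
  have coeff: "4 / (36 - k\<^sup>2) = 16 / 135"
    unfolding assms(1) by (simp add: power2_eq_square)
  show ?thesis
    unfolding assms(2-5) coeff
    by (simp add: field_simps power2_eq_square power3_eq_cube power4_eq_xxxx)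
qed

theorem mainTheorem2:
  fixes I :: "real set" and y p u :: "real \<Rightarrow> real" and k :: real
  assumes "open I" and "is_interval I"
    and "smooth_on I y"
    and "\<forall>t\<in>I. (deriv ^^ 3) y t > 0"
    and "\<forall>t\<in>I. (deriv ^^ 3) y t = exp (p t)"
    and "\<forall>t\<in>I. u t = 3 / 2 * deriv p t"
    and "k\<^sup>2 = (3 / 2)\<^sup>2"
  shows "(\<forall>t\<in>I. 10 * ((deriv ^^ 3) y t)^3 * (deriv ^^ 7) y t
              - 70 * ((deriv ^^ 3) y t)^2 * (deriv ^^ 4) y t * (deriv ^^ 6) y t
              - 49 * ((deriv ^^ 3) y t)^2 * ((deriv ^^ 5) y t)^2
              + 280 * (deriv ^^ 3) y t * ((deriv ^^ 4) y t)^2 * (deriv ^^ 5) y t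
              - 175 * ((deriv ^^ 4) y t)^4 = 0)
         \<longleftrightarrow> satisfies_generalised_chazy_on I k u"
proof -
  define w where "w = (deriv ^^ 3) y"
  define a where "a j t = (deriv ^^ (3 + j)) y t / w t" for j t
  note transfer = has_real_derivative_transfer_on_open[OF assms(1)]
  have w_pos: "w t > 0" if "t \<in> I" for t
    using assms(4) that by (simp add: w_def)
  have dw: "(w has_real_derivative (deriv ^^ 4) y t) (at t)" if "t \<in> I" for t
    using smooth_on_has_real_derivative[OF assms(1,3) that, of 3]
    by (simp add: w_def eval_nat_numeral)
  have da: "(a j has_real_derivative a (Suc j) t - a 1 t * a j t) (at t)" if "t \<in> I" for j t
    using has_real_derivative_quotient_by_base[OF dw[OF that]
        smooth_on_has_real_derivative[OF assms(1,3) that, of "3 + j"]] w_pos[OF that]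
    unfolding a_def by simp

  have u0: "u t = 3 / 2 * a 1 t" if "t \<in> I" for t
  proof -
    have p: "p s = ln (w s)" if "s \<in> I" for s
      using assms(5) that by (simp add: w_def)
    have "((\<lambda>s. ln (w s)) has_real_derivative a 1 t) (at t)"
      using dw[OF that] w_pos[OF that]
      by (auto intro!: derivative_eq_intros simp: a_def)
    from transfer[OF that p this] have "(p has_real_derivative a 1 t) (at t)" .
    then show ?thesis
      using assms(6) that by (simp add: DERIV_imp_deriv)
  qed
  have da1: "(a 1 has_real_derivative a 2 t - (a 1 t)^2) (at t)"
    and da2: "(a 2 has_real_derivative a 3 t - a 1 t * a 2 t) (at t)"
    and da3: "(a 3 has_real_derivative a 4 t - a 1 t * a 3 t) (at t)" if "t \<in> I" for t
    using da[OF that, of 1] da[OF that, of 2] da[OF that, of 3]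
    by (simp_all add: power2_eq_square eval_nat_numeral)
  have du0: "(u has_real_derivative 3 / 2 * (a 2 t - (a 1 t)^2)) (at t)" if "t \<in> I" for t
    by (rule transfer[OF that u0], assumption)
      (auto intro!: derivative_eq_intros da1[OF that] simp del: One_nat_def)
  have u1: "deriv u t = 3 / 2 * (a 2 t - (a 1 t)^2)" if "t \<in> I" for t
    by (rule DERIV_imp_deriv[OF du0[OF that]])
  have du1: "(deriv u has_real_derivative
      3 / 2 * (a 3 t - 3 * a 1 t * a 2 t + 2 * (a 1 t)^3)) (at t)" if "t \<in> I" for t
    by (rule transfer[OF that u1], assumption)
      (auto intro!: derivative_eq_intros da1[OF that] da2[OF that]
        simp: field_simps power2_eq_square power3_eq_cube simp del: One_nat_def)
  have u2: "(deriv ^^ 2) u t = 3 / 2 * (a 3 t - 3 * a 1 t * a 2 t + 2 * (a 1 t)^3)"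
    if "t \<in> I" for t
    using DERIV_imp_deriv[OF du1[OF that]] by (simp add: numeral_2_eq_2)
  have du2: "((deriv ^^ 2) u has_real_derivative
      3 / 2 * (a 4 t - 4 * a 1 t * a 3 t - 3 * (a 2 t)^2 + 12 * (a 1 t)^2 * a 2 t
        - 6 * (a 1 t)^4)) (at t)" if "t \<in> I" for t
    by (rule transfer[OF that u2], assumption)
      (auto intro!: derivative_eq_intros da1[OF that] da2[OF that] da3[OF that]
        simp: field_simps power2_eq_square power3_eq_cube power4_eq_xxxx simp del: One_nat_def)
  have u3: "(deriv ^^ 3) u t = 3 / 2 * (a 4 t - 4 * a 1 t * a 3 t - 3 * (a 2 t)^2
        + 12 * (a 1 t)^2 * a 2 t - 6 * (a 1 t)^4)" if "t \<in> I" for t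
    using DERIV_imp_deriv[OF du2[OF that]] by (simp add: eval_nat_numeral)

  have diff: "(deriv ^^ n) u differentiable_on I" if "n < 3" for n
  proof -
    have "\<exists>D. ((deriv ^^ n) u has_real_derivative D) (at t)" if "t \<in> I" for t
    proof -
      have "n = 0 \<or> n = 1 \<or> n = 2"
        using \<open>n < 3\<close> by linarith
      moreover have "(deriv ^^ 0) u = u" "(deriv ^^ 1) u = deriv u"
        by simp_all
      ultimately show ?thesis
        using du0[OF that] du1[OF that] du2[OF that] by metis
    qed
    then show ?thesis
      unfolding differentiable_on_eq_differentiable_at[OF assms(1)] real_differentiable_def
      by blast
  qed
  have k: "k \<noteq> 6" "k \<noteq> -6"
    using assms(7) by (auto simp: power2_eq_square)
  have equiv: "(10 * w t^3 * (deriv ^^ 7) y t - 70 * (w t)^2 * (deriv ^^ 4) y t * (deriv ^^ 6) y t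
              - 49 * (w t)^2 * ((deriv ^^ 5) y t)^2
              + 280 * w t * ((deriv ^^ 4) y t)^2 * (deriv ^^ 5) y t
              - 175 * ((deriv ^^ 4) y t)^4 = 0) \<longleftrightarrow>
        ((deriv ^^ 3) u t - 2 * u t * (deriv ^^ 2) u t + 3 * (deriv u t)\<^sup>2
            - 4 / (36 - k\<^sup>2) * (6 * deriv u t - (u t)\<^sup>2)\<^sup>2 = 0)"
    (is "?L = 0 \<longleftrightarrow> ?R = 0") if "t \<in> I" for t
  proof -
    have derivs: "(deriv ^^ 4) y t = w t * a 1 t" "(deriv ^^ 5) y t = w t * a 2 t"
      "(deriv ^^ 6) y t = w t * a 3 t" "(deriv ^^ 7) y t = w t * a 4 t"
      using w_pos[OF that] by (simp_all add: a_def)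
    have "?L = 20 / 3 * w t ^ 4 * ?R"
      unfolding derivs
      by (rule chazy_quotient_identity[OF assms(7) u0 u1 u2 u3, OF that that that that])
    moreover have "20 / 3 * w t ^ 4 \<noteq> 0"
      using w_pos[OF that] by simp
    ultimately show ?thesis
      by (metis mult_eq_0_iff)
  qed
  show ?thesis
    unfolding satisfies_generalised_chazy_on_def using k diff
    by (simp only: equiv[unfolded w_def] simp_thms cong: ball_cong) simp
qed

end
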